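(* Let $k\ge 1$. For all $\Upsilon\subseteq\mathcal{F}_{2,k}$, $$D^{\Upsilon}(x,t)=\frac{1-x}{1-x+\sum_{n\ge 1}\frac{((x-1)t)^n}{(kn)!}\,full^{\Upsilon}_n},$$ where $$D^{\Upsilon}(x,t)=1+\sum_{n\ge 1}\frac{t^n}{(kn)!}\sum_{F\in\mathcal{F}_{n,k}}x^{\Upsilon\text{-mch}(F)}.$$
   Context: $\mathcal{F}_{n,k}$ is the set of all fillings $F$ of the $k\times n$ rectangular array ($k$ rows, $n$ columns) with the integers $1,\dots,kn$, each used once, such that the elements in each column increase from bottom to top. $F(i,j)$ is the entry in the $i$-th row from the bottom and $j$-th column from the left. For a filling of a $k\times n$ array by distinct positive integers with columns increasing from bottom to top, $\mathrm{red}(F)\in\mathcal{F}_{n,k}$ is obtained by replacing the $i$-th smallest entry by $i$. $F[c_1,\dots,c_j]$ is the filling of the $k\times j$ array whose $a$-th column is column $c_a$ of $F$. For $\Upsilon\subseteq\mathcal{F}_{2,k}$, $F\in\mathcal{F}_{n,k}$ has an $\Upsilon$-match starting at position $i$ ($1\le i\le n-1$) if $\mathrm{red}(F[i,i+1])\in\Upsilon$. $\Upsilon\text{-mch}(F)$ is the number of $\Upsilon$-matches in $F$. $full^{\Upsilon}_n$ is the number of $F\in\mathcal{F}_{n,k}$ with $\Upsilon\text{-mch}(F)=n-1$ (i.e. with $\Upsilon$-matches starting at every position $1,\dots,n-1$), with $full^{\Upsilon}_1=1$ by convention. The identity is one of formal power series in $t$ with coefficients in $\mathbb{Q}(x)$.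 *)

theory Defs
  imports
    "HOL-Library.FuncSet"
    "HOL-Computational_Algebra.Computational_Algebra"
begin

text \<open>
  Cells are pairs (row from the bottom, column from the left), both counted from 1.
  A filling is an extensional function on the cells, so that distinct functions are
  distinct fillings.
\<close>

definition cells :: "nat \<Rightarrow> nat \<Rightarrow> (nat \<times> nat) set" where
  "cells k n = {1..k} \<times> {1..n}"

definition fillings :: "nat \<Rightarrow> nat \<Rightarrow> (nat \<times> nat \<Rightarrow> nat) set" where
  "fillings n k = {F \<in> extensional (cells k n).
     bij_betw F (cells k n) {1..k * n} \<and>
     (\<forall>j\<in>{1..n}. \<forall>i\<in>{1..k}. \<forall>i'\<in>{1..k}. i < i' \<longrightarrow> F (i, j) < F (i', j))}"

text \<open>The \<open>i\<close>-th smallest entry is the one with exactly \<open>i\<close> entries not exceeding it.\<close>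

definition red :: "nat \<Rightarrow> nat \<Rightarrow> (nat \<times> nat \<Rightarrow> nat) \<Rightarrow> nat \<times> nat \<Rightarrow> nat" where
  "red n k F = (\<lambda>c\<in>cells k n. card {d \<in> cells k n. F d \<le> F c})"

definition subcols :: "nat \<Rightarrow> (nat \<times> nat \<Rightarrow> nat) \<Rightarrow> nat list \<Rightarrow> nat \<times> nat \<Rightarrow> nat" where
  "subcols k F cs = (\<lambda>(i, a)\<in>cells k (length cs). F (i, cs ! (a - 1)))"

definition match_at ::
    "nat \<Rightarrow> (nat \<times> nat \<Rightarrow> nat) set \<Rightarrow> (nat \<times> nat \<Rightarrow> nat) \<Rightarrow> nat \<Rightarrow> bool" where
  "match_at k Y F i \<longleftrightarrow> red 2 k (subcols k F [i, i + 1]) \<in> Y"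

definition mch ::
    "nat \<Rightarrow> nat \<Rightarrow> (nat \<times> nat \<Rightarrow> nat) set \<Rightarrow> (nat \<times> nat \<Rightarrow> nat) \<Rightarrow> nat" where
  "mch n k Y F = card {i \<in> {1..n - 1}. match_at k Y F i}"

definition full :: "nat \<Rightarrow> (nat \<times> nat \<Rightarrow> nat) set \<Rightarrow> nat \<Rightarrow> nat" where
  "full k Y n = (if n = 1 then 1 else card {F \<in> fillings n k. mch n k Y F = n - 1})"

text \<open>The field of rational functions over the rationals, and its indeterminate \<open>x\<close>.\<close>

type_synonym ratfun = "rat poly fract"

definition x_var :: ratfun where
  "x_var = to_fract [:0, 1:]"

text \<open>Power series in \<open>t\<close> are given by their coefficient sequences.\<close>

definition D_series :: "nat \<Rightarrow> (nat \<times> nat \<Rightarrow> nat) set \<Rightarrow> ratfun fps" where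
  "D_series k Y = 1 + Abs_fps (\<lambda>n. if n = 0 then 0
     else (\<Sum>F\<in>fillings n k. x_var ^ mch n k Y F) / of_nat (fact (k * n)))"

definition full_series :: "nat \<Rightarrow> (nat \<times> nat \<Rightarrow> nat) set \<Rightarrow> ratfun fps" where
  "full_series k Y = Abs_fps (\<lambda>n. if n = 0 then 0
     else (x_var - 1) ^ n / of_nat (fact (k * n)) * of_nat (full k Y n))"

text \<open>
  Checks on the encoding: there are finitely many fillings, reduction yields a filling,
  and the convention \<open>full k Y 1 = 1\<close> agrees with the general formula.
\<close>

lemma finite_cells [simp]: "finite (cells k n)"
  by (simp add: cells_def)

lemma card_cells [simp]: "card (cells k n) = k * n"
  by (simp add: cells_def)

lemma finite_fillings: "finite (fillings n k)"
proof (rule finite_subset)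
  show "fillings n k \<subseteq> cells k n \<rightarrow>\<^sub>E {1..k * n}"
    by (auto simp: fillings_def PiE_def bij_betw_def)
  show "finite (cells k n \<rightarrow>\<^sub>E {1..k * n})"
    by (intro finite_PiE) auto
qed

lemma red_less_iff:
  assumes "c \<in> cells k n" "d \<in> cells k n"
  shows "red n k F c < red n k F d \<longleftrightarrow> F c < F d"
proof -
  have less: "red n k F a < red n k F b"
    if "F a < F b" "a \<in> cells k n" "b \<in> cells k n" for a b
  proof -
    have "{e \<in> cells k n. F e \<le> F a} \<subset> {e \<in> cells k n. F e \<le> F b}"
    proof
      show "{e \<in> cells k n. F e \<le> F a} \<subseteq> {e \<in> cells k n. F e \<le> F b}"
        using that by auto
      have "b \<in> {e \<in> cells k n. F e \<le> F b}" "b \<notin> {e \<in> cells k n. F e \<le> F a}"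
        using that by auto
      then show "{e \<in> cells k n. F e \<le> F a} \<noteq> {e \<in> cells k n. F e \<le> F b}"
        by blast
    qed
    then show ?thesis
      using that by (simp add: red_def psubset_card_mono)
  qed
  have "red n k F c = red n k F d" if "F c = F d"
    using that assms by (simp add: red_def)
  then show ?thesis
    using less[of c d] less[of d c] assms by (cases "F c" "F d" rule: linorder_cases) auto
qed

lemma red_in_fillings:
  assumes "inj_on F (cells k n)"
    and "\<And>i i' j. j \<in> {1..n} \<Longrightarrow> i \<in> {1..k} \<Longrightarrow> i' \<in> {1..k} \<Longrightarrow> i < i' \<Longrightarrow> F (i, j) < F (i', j)"
  shows "red n k F \<in> fillings n k"
proof -
  have inj: "inj_on (red n k F) (cells k n)"
  proof (rule inj_onI)
    fix c d assume cd: "c \<in> cells k n" "d \<in> cells k n" "red n k F c = red n k F d"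
    then have "F c = F d"
      using red_less_iff[of c k n d F] red_less_iff[of d k n c F] by simp
    then show "c = d"
      using assms(1) cd by (auto dest: inj_onD)
  qed
  have "red n k F ` cells k n \<subseteq> {1..k * n}"
  proof safe
    fix a b assume c: "(a, b) \<in> cells k n"
    have "card {d \<in> cells k n. F d \<le> F (a, b)} \<le> k * n"
      using card_mono[of "cells k n" "{d \<in> cells k n. F d \<le> F (a, b)}"] by auto
    moreover have "card {d \<in> cells k n. F d \<le> F (a, b)} > 0"
      using c by (auto simp: card_gt_0_iff)
    ultimately show "red n k F (a, b) \<in> {1..k * n}"
      using c by (simp add: red_def)
  qed
  then have "red n k F ` cells k n = {1..k * n}"
    using inj by (intro card_subset_eq) (auto simp: card_image)
  moreover have "red n k F (i, j) < red n k F (i', j)"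
    if "j \<in> {1..n}" "i \<in> {1..k}" "i' \<in> {1..k}" "i < i'" for i i' j
    using red_less_iff[of "(i, j)" k n "(i', j)" F] assms(2)[OF that] that
    by (simp add: cells_def)
  ultimately show ?thesis
    using inj by (auto simp: fillings_def bij_betw_def red_def)
qed

lemma full_1_consistent: "card {F \<in> fillings 1 k. mch 1 k Y F = 1 - 1} = full k Y 1"
proof -
  let ?G = "\<lambda>(i, j)\<in>cells k 1. i"
  have "?G \<in> fillings 1 k"
    by (auto simp: fillings_def bij_betw_def inj_on_def cells_def image_def)
  moreover have "F = ?G" if F: "F \<in> fillings 1 k" for F
  proof
    let ?f = "\<lambda>i. F (i, 1)"
    have mono: "i \<in> {1..k} \<Longrightarrow> i' \<in> {1..k} \<Longrightarrow> i < i' \<Longrightarrow> ?f i < ?f i'" for i i'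
      using F by (auto simp: fillings_def)
    have bij: "F ` cells k 1 = {1..k}"
      using F by (auto simp: fillings_def bij_betw_def)
    have range: "i \<in> {1..k} \<Longrightarrow> ?f i \<in> {1..k}" for i
      using bij by (auto simp: cells_def)
    have lower: "i \<le> k \<Longrightarrow> 1 \<le> i \<Longrightarrow> i \<le> ?f i" for i
    proof (induction i)
      case (Suc i)
      show ?case
      proof (cases "i = 0")
        case True
        then show ?thesis using range[of "Suc i"] Suc by simp
      next
        case False
        then have "i \<le> ?f i" using Suc by simp
        moreover have "?f i < ?f (Suc i)" using mono[of i "Suc i"] Suc False by simp
        ultimately show ?thesis by simp
      qed
    qed simp
    have upper: "m < k \<Longrightarrow> ?f (k - m) \<le> k - m" for m
    proof (induction m)
      case 0
      then show ?case using range[of k] by simp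
    next
      case (Suc m)
      have "?f (k - Suc m) < ?f (k - m)"
        using mono[of "k - Suc m" "k - m"] Suc by simp
      then show ?case using Suc by simp
    qed
    have eq: "?f i = i" if "i \<in> {1..k}" for i
      using lower[of i] upper[of "k - i"] that by simp
    fix c show "F c = ?G c"
    proof (cases "c \<in> cells k 1")
      case True
      then obtain i where "c = (i, 1)" "i \<in> {1..k}" by (auto simp: cells_def)
      then show ?thesis using eq[of i] True by simp
    next
      case False
      have "F \<in> extensional (cells k 1)"
        using F unfolding fillings_def by blast
      then have "F c = undefined"
        using False by (rule extensional_arb)
      moreover have "?G c = undefined"
        using False unfolding restrict_def by (rule if_not_P)
      ultimately show ?thesis by (rule trans[OF _ sym])
    qed
  qed
  ultimately have "fillings 1 k = {?G}" by blast
  moreover have "mch 1 k Y F = 0" for F by (simp add: mch_def)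
  ultimately show ?thesis by (simp add: full_def)
qed

end

theory Submission
  imports Defs
begin

text \<open>
  Write \<open>A n\<close> for the sum of \<open>x ^ mch n k \<Upsilon> F\<close> over all fillings \<open>F\<close> with \<open>n\<close> columns. After
  multiplication by the denominator, which is nonzero because its constant term is \<open>1 - x\<close>, and
  comparison of the coefficients of \<open>t ^ n\<close>, the identity for \<open>n \<ge> 1\<close> becomes
  \<open>(x - 1) / of_nat (fact (k * n))\<close> times the recurrence \<open>sum_fillings_recurrence\<close>,
  which expresses \<open>A n\<close> as the sum over \<open>1 \<le> m \<le> n\<close> of
  \<open>(x - 1) ^ (m - 1) * (of_nat ((k * n) choose (k * m)) * (of_nat (full k \<Upsilon> m) * A (n - m)))\<close>.

  The recurrence holds for two reasons. First, cutting a filling after its \<open>m\<close>-th column gives a set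
  of \<open>k * m\<close> values together with, after reduction of both parts, a filling with \<open>m\<close> columns and one
  with \<open>n - m\<close> columns; this is a bijection, and reduction preserves matches. So
  \<open>of_nat ((k * n) choose (k * m)) * (of_nat (full k \<Upsilon> m) * A (n - m))\<close> is a sum over the fillings
  with \<open>n\<close> columns that have matches at all the positions below \<open>m\<close>, each weighted by \<open>x\<close> to the
  number of its matches at positions above \<open>m\<close>; whether there is a match at \<open>m\<close> itself, where the
  two parts meet, is irrelevant (\<open>sum_fillings_split\<close>). Second, for a single filling, the sum of
  these weights times \<open>(x - 1) ^ (m - 1)\<close> telescopes to \<open>x\<close> to the number of all its matches
  (\<open>power_count_eq_sum_runs\<close>).
\<close>

section \<open>Columns with entries from an arbitrary set\<close>

text \<open>Fillings of the \<open>k \<times> n\<close> array whose set of entries is \<open>S\<close> instead of \<open>{1..k * n}\<close>.\<close>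

definition set_fillings :: "nat set \<Rightarrow> nat \<Rightarrow> nat \<Rightarrow> (nat \<times> nat \<Rightarrow> nat) set" where
  "set_fillings S n k = {F \<in> extensional (cells k n).
     bij_betw F (cells k n) S \<and>
     (\<forall>j\<in>{1..n}. \<forall>i\<in>{1..k}. \<forall>i'\<in>{1..k}. i < i' \<longrightarrow> F (i, j) < F (i', j))}"

lemma fillings_eq_set_fillings: "fillings n k = set_fillings {1..k * n} n k"
  by (simp add: fillings_def set_fillings_def)

lemma finite_set_fillings:
  assumes "finite S"
  shows "finite (set_fillings S n k)"
proof (rule finite_subset)
  show "set_fillings S n k \<subseteq> cells k n \<rightarrow>\<^sub>E S"
    by (auto simp: set_fillings_def PiE_def bij_betw_def)
  show "finite (cells k n \<rightarrow>\<^sub>E S)"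
    using assms by (intro finite_PiE) auto
qed

text \<open>
  The position of \<open>v\<close> in the increasing enumeration of \<open>S\<close>, counted from 1, if \<open>v \<in> S\<close> and \<open>S\<close> is
  finite. On a filling, reduction is composition with the rank function of its set of entries.
\<close>

definition rank :: "nat set \<Rightarrow> nat \<Rightarrow> nat" where
  "rank S v = card {u \<in> S. u \<le> v}"

lemma rank_less:
  assumes "finite S" "u < v" "v \<in> S"
  shows "rank S u < rank S v"
proof -
  have "v \<in> {w \<in> S. w \<le> v}" "v \<notin> {w \<in> S. w \<le> u}"
    using assms by auto
  moreover have "{w \<in> S. w \<le> u} \<subseteq> {w \<in> S. w \<le> v}"
    using assms by auto
  ultimately have "{w \<in> S. w \<le> u} \<subset> {w \<in> S. w \<le> v}"
    by blast
  then show ?thesis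
    using assms by (simp add: rank_def psubset_card_mono)
qed

lemma rank_less_iff:
  assumes "finite S" "u \<in> S" "v \<in> S"
  shows "rank S u < rank S v \<longleftrightarrow> u < v"
  using rank_less[of S u v] rank_less[of S v u] assms by (cases u v rule: linorder_cases) auto

lemma bij_betw_rank:
  assumes "finite S"
  shows "bij_betw (rank S) S {1..card S}"
proof -
  have inj: "inj_on (rank S) S"
    using rank_less_iff[OF assms] by (intro inj_onI) (metis less_irrefl linorder_neqE_nat)
  have "rank S ` S \<subseteq> {1..card S}"
  proof safe
    fix v assume "v \<in> S"
    then have "rank S v > 0"
      using assms by (auto simp: rank_def card_gt_0_iff)
    moreover have "rank S v \<le> card S"
      using assms by (auto simp: rank_def intro: card_mono)
    ultimately show "rank S v \<in> {1..card S}" by simp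
  qed
  then have "rank S ` S = {1..card S}"
    using inj by (intro card_subset_eq) (auto simp: card_image)
  with inj show ?thesis by (simp add: bij_betw_def)
qed

lemma red_eq_rank:
  assumes "bij_betw F (cells k n) S"
  shows "red n k F = (\<lambda>c\<in>cells k n. rank S (F c))"
proof -
  have "card {d \<in> cells k n. F d \<le> F c} = rank S (F c)" for c
  proof -
    have "{u \<in> S. u \<le> F c} = F ` {d \<in> cells k n. F d \<le> F c}"
      using assms by (auto simp: bij_betw_def)
    moreover have "inj_on F {d \<in> cells k n. F d \<le> F c}"
      using assms by (auto simp: bij_betw_def inj_on_def)
    ultimately show ?thesis by (simp add: rank_def card_image)
  qed
  then show ?thesis by (simp add: red_def)
qed

text \<open>
  The inverse of reduction replaces each entry \<open>r\<close> by the \<open>r\<close>-th smallest element of \<open>S\<close>, which is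
  the preimage of \<open>r\<close> under the rank function of \<open>S\<close>.
\<close>

lemma bij_betw_red:
  assumes "finite S" "card S = k * n"
  shows "bij_betw (red n k) (set_fillings S n k) (fillings n k)"
proof (rule bij_betw_byWitness[where f' = "\<lambda>G. \<lambda>c\<in>cells k n. inv_into S (rank S) (G c)"])
  have rank: "bij_betw (rank S) S {1..k * n}"
    using bij_betw_rank[of S] assms by simp
  note unrank = bij_betw_inv_into[OF rank]
  have unrank_in: "inv_into S (rank S) r \<in> S" if "r \<in> {1..k * n}" for r
    using that unrank by (meson bij_betwE)
  have rank_unrank: "rank S (inv_into S (rank S) r) = r" if "r \<in> {1..k * n}" for r
    using that rank by (meson bij_betw_inv_into_right)
  have unrank_bij: "bij_betw (\<lambda>c\<in>cells k n. inv_into S (rank S) (G c)) (cells k n) S"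
    if "bij_betw G (cells k n) {1..k * n}" for G
    using bij_betw_trans[OF that unrank]
    by (rule bij_betw_cong[THEN iffD1, rotated]) simp
  show "\<forall>F\<in>set_fillings S n k. (\<lambda>c\<in>cells k n. inv_into S (rank S) (red n k F c)) = F"
  proof
    fix F assume F: "F \<in> set_fillings S n k"
    then have bij: "bij_betw F (cells k n) S" and ext: "F \<in> extensional (cells k n)"
      by (auto simp: set_fillings_def)
    show "(\<lambda>c\<in>cells k n. inv_into S (rank S) (red n k F c)) = F"
    proof (rule extensionalityI[OF restrict_extensional ext])
      fix c assume c: "c \<in> cells k n"
      then have "F c \<in> S" using bij by (meson bij_betwE)
      then show "(\<lambda>c\<in>cells k n. inv_into S (rank S) (red n k F c)) c = F c"
        using c rank by (simp add: red_eq_rank[OF bij] bij_betw_def)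
    qed
  qed
  show "\<forall>G\<in>fillings n k. red n k (\<lambda>c\<in>cells k n. inv_into S (rank S) (G c)) = G"
  proof
    fix G assume G: "G \<in> fillings n k"
    then have bij: "bij_betw G (cells k n) {1..k * n}" and ext: "G \<in> extensional (cells k n)"
      unfolding fillings_def by blast+
    show "red n k (\<lambda>c\<in>cells k n. inv_into S (rank S) (G c)) = G"
      unfolding red_eq_rank[OF unrank_bij[OF bij]]
    proof (rule extensionalityI[OF restrict_extensional ext])
      fix c assume c: "c \<in> cells k n"
      then have "G c \<in> {1..k * n}" using bij by (meson bij_betwE)
      then show "(\<lambda>c\<in>cells k n. rank S ((\<lambda>c\<in>cells k n. inv_into S (rank S) (G c)) c)) c = G c"
        using c rank_unrank by simp
    qed
  qed
  show "red n k ` set_fillings S n k \<subseteq> fillings n k"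
    by (auto simp: set_fillings_def bij_betw_def intro!: red_in_fillings)
  show "(\<lambda>G. \<lambda>c\<in>cells k n. inv_into S (rank S) (G c)) ` fillings n k \<subseteq> set_fillings S n k"
  proof safe
    fix G assume G: "G \<in> fillings n k"
    then have bij: "bij_betw G (cells k n) {1..k * n}"
      unfolding fillings_def by blast
    let ?F = "\<lambda>c\<in>cells k n. inv_into S (rank S) (G c)"
    have "?F (i, j) < ?F (i', j)"
      if ij: "j \<in> {1..n}" "i \<in> {1..k}" "i' \<in> {1..k}" "i < i'" for i i' j
    proof -
      have c: "(i, j) \<in> cells k n" "(i', j) \<in> cells k n"
        using ij by (auto simp: cells_def)
      then have *: "G (i, j) \<in> {1..k * n}" "G (i', j) \<in> {1..k * n}"
        using bij by (meson bij_betwE)+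
      have "G (i, j) < G (i', j)"
        using G ij unfolding fillings_def by blast
      then have "inv_into S (rank S) (G (i, j)) < inv_into S (rank S) (G (i', j))"
        using rank_less_iff[OF assms(1) unrank_in[OF *(1)] unrank_in[OF *(2)]]
        by (simp only: rank_unrank[OF *(1)] rank_unrank[OF *(2)])
      then show ?thesis using c by simp
    qed
    then show "?F \<in> set_fillings S n k"
      using unrank_bij[OF bij] unfolding set_fillings_def by blast
  qed
qed

lemma red_cong:
  assumes "\<And>c d. c \<in> cells k n \<Longrightarrow> d \<in> cells k n \<Longrightarrow> F d \<le> F c \<longleftrightarrow> G d \<le> G c"
  shows "red n k F = red n k G"
  unfolding red_def
proof (rule restrict_ext)
  fix c assume "c \<in> cells k n"
  then have "{d \<in> cells k n. F d \<le> F c} = {d \<in> cells k n. G d \<le> G c}"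
    using assms by blast
  then show "card {d \<in> cells k n. F d \<le> F c} = card {d \<in> cells k n. G d \<le> G c}" by simp
qed

lemma subcols_pair:
  "subcols k F [i, i + 1] = (\<lambda>(r, a)\<in>cells k 2. F (r, if a = 1 then i else i + 1))"
proof -
  have "[i, i + 1] ! (a - 1) = (if a = 1 then i else i + 1)" if "a \<in> {1..2}" for a :: nat
  proof -
    have "a = 1 \<or> a = 2" using that by auto
    then show ?thesis by auto
  qed
  then show ?thesis
    unfolding subcols_def by (intro ext) (auto simp: cells_def restrict_def)
qed

lemma match_at_red:
  assumes "1 \<le> i" "i < n"
  shows "match_at k Y (red n k F) i \<longleftrightarrow> match_at k Y F i"
proof -
  have "red 2 k (subcols k (red n k F) [i, i + 1]) = red 2 k (subcols k F [i, i + 1])"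
  proof (rule red_cong)
    fix c d assume cd: "c \<in> cells k 2" "d \<in> cells k 2"
    obtain r a s b where [simp]: "c = (r, a)" "d = (s, b)" by (cases c, cases d)
    have "(r, if a = 1 then i else i + 1) \<in> cells k n" "(s, if b = 1 then i else i + 1) \<in> cells k n"
      using cd assms by (auto simp: cells_def)
    from red_less_iff[OF this, of F]
    have "red n k F (s, if b = 1 then i else i + 1) \<le> red n k F (r, if a = 1 then i else i + 1)
        \<longleftrightarrow> F (s, if b = 1 then i else i + 1) \<le> F (r, if a = 1 then i else i + 1)"
      by (metis linorder_not_less)
    then show "subcols k (red n k F) [i, i + 1] d \<le> subcols k (red n k F) [i, i + 1] c
        \<longleftrightarrow> subcols k F [i, i + 1] d \<le> subcols k F [i, i + 1] c"
      using cd unfolding subcols_pair by simp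
  qed
  then show ?thesis by (simp add: match_at_def)
qed

lemma mch_red: "mch n k Y (red n k F) = mch n k Y F"
proof -
  have "{i \<in> {1..n - 1}. match_at k Y (red n k F) i} = {i \<in> {1..n - 1}. match_at k Y F i}"
    by (auto simp: match_at_red)
  then show ?thesis by (simp add: mch_def)
qed

lemma sum_mch_set_fillings:
  fixes f :: "nat \<Rightarrow> 'a :: comm_monoid_add"
  assumes "finite S" "card S = k * n"
  shows "(\<Sum>F\<in>set_fillings S n k. f (mch n k Y F)) = (\<Sum>F\<in>fillings n k. f (mch n k Y F))"
  using sum.reindex_bij_betw[OF bij_betw_red[OF assms], of "\<lambda>F. f (mch n k Y F)"]
  by (simp add: mch_red)

section \<open>Splitting an array into its first and last columns\<close>

text \<open>The first \<open>m\<close> columns of an array; their entries are kept and not reduced.\<close>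

definition first_cols :: "nat \<Rightarrow> nat \<Rightarrow> (nat \<times> nat \<Rightarrow> nat) \<Rightarrow> nat \<times> nat \<Rightarrow> nat" where
  "first_cols m k F = restrict F (cells k m)"

text \<open>
  The \<open>n\<close> columns that follow the first \<open>m\<close> columns of an array, renumbered from 1; their entries
  are kept and not reduced.
\<close>

definition last_cols :: "nat \<Rightarrow> nat \<Rightarrow> nat \<Rightarrow> (nat \<times> nat \<Rightarrow> nat) \<Rightarrow> nat \<times> nat \<Rightarrow> nat" where
  "last_cols m n k F = (\<lambda>(i, j)\<in>cells k n. F (i, j + m))"

text \<open>The array with the \<open>m\<close> columns of \<open>G\<close> followed by the \<open>n\<close> columns of \<open>H\<close>.\<close>

definition join_cols ::
    "nat \<Rightarrow> nat \<Rightarrow> nat \<Rightarrow> (nat \<times> nat \<Rightarrow> nat) \<Rightarrow> (nat \<times> nat \<Rightarrow> nat) \<Rightarrow> nat \<times> nat \<Rightarrow> nat" where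
  "join_cols m n k G H =
     (\<lambda>(i, j)\<in>cells k (m + n). if j \<le> m then G (i, j) else H (i, j - m))"

lemma bij_betw_shift_cells:
  "bij_betw (\<lambda>(i, j). (i, j + m)) (cells k n) (cells k (m + n) - cells k m)"
  by (rule bij_betw_byWitness[where f' = "\<lambda>(i, j). (i, j - m)"]) (auto simp: cells_def)

lemma cells_mono: "cells k m \<subseteq> cells k (m + n)"
  by (auto simp: cells_def)

lemma first_cols_in_set_fillings:
  assumes "F \<in> set_fillings T (m + n) k"
  shows "first_cols m k F \<in> set_fillings (F ` cells k m) m k"
proof -
  have "inj_on F (cells k m)"
    using assms inj_on_subset[OF _ cells_mono] by (auto simp: set_fillings_def bij_betw_def)
  then have "bij_betw (first_cols m k F) (cells k m) (F ` cells k m)"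
    by (simp add: bij_betw_def first_cols_def inj_on_restrict_eq)
  then show ?thesis
    using assms by (auto simp: set_fillings_def first_cols_def cells_def)
qed

lemma last_cols_in_set_fillings:
  assumes "F \<in> set_fillings T (m + n) k"
  shows "last_cols m n k F \<in> set_fillings (T - F ` cells k m) n k"
proof -
  have bij: "bij_betw F (cells k (m + n)) T"
    using assms by (auto simp: set_fillings_def)
  have "bij_betw F (cells k (m + n) - cells k m) (T - F ` cells k m)"
    using bij cells_mono[of k m n]
    by (auto simp: bij_betw_def inj_on_diff inj_on_image_set_diff[of F "cells k (m + n)"])
  from bij_betw_trans[OF bij_betw_shift_cells this]
  have "bij_betw (last_cols m n k F) (cells k n) (T - F ` cells k m)"
    by (rule bij_betw_cong[THEN iffD1, rotated]) (auto simp: last_cols_def)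
  then show ?thesis
    using assms by (auto simp: set_fillings_def last_cols_def cells_def)
qed

lemma join_cols_in_set_fillings:
  assumes G: "G \<in> set_fillings S m k" and H: "H \<in> set_fillings (T - S) n k" and "S \<subseteq> T"
  shows "join_cols m n k G H \<in> set_fillings T (m + n) k"
proof -
  let ?J = "join_cols m n k G H"
  have "bij_betw G (cells k m) S" using G by (auto simp: set_fillings_def)
  then have 1: "bij_betw ?J (cells k m) S"
    by (rule bij_betw_cong[THEN iffD1, rotated]) (auto simp: join_cols_def cells_def)
  have "bij_betw (\<lambda>(i, j). (i, j - m)) (cells k (m + n) - cells k m) (cells k n)"
    by (rule bij_betw_byWitness[where f' = "\<lambda>(i, j). (i, j + m)"]) (auto simp: cells_def)
  moreover have "bij_betw H (cells k n) (T - S)" using H by (auto simp: set_fillings_def)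
  ultimately have "bij_betw (H \<circ> (\<lambda>(i, j). (i, j - m))) (cells k (m + n) - cells k m) (T - S)"
    by (rule bij_betw_trans)
  then have 2: "bij_betw ?J (cells k (m + n) - cells k m) (T - S)"
    by (rule bij_betw_cong[THEN iffD1, rotated]) (auto simp: join_cols_def cells_def split: if_splits)
  have "bij_betw ?J (cells k m \<union> (cells k (m + n) - cells k m)) (S \<union> (T - S))"
    using 1 2 by (rule bij_betw_combine) auto
  then have "bij_betw ?J (cells k (m + n)) T"
    using \<open>S \<subseteq> T\<close> cells_mono[of k m n] by (simp add: Un_absorb1)
  moreover have "?J (i, j) < ?J (i', j)"
    if ij: "j \<in> {1..m + n}" "i \<in> {1..k}" "i' \<in> {1..k}" "i < i'" for i i' j
  proof (cases "j \<le> m")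
    case True
    then have "G (i, j) < G (i', j)" using ij G by (auto simp: set_fillings_def)
    then show ?thesis using True ij by (simp add: join_cols_def cells_def)
  next
    case False
    then have "j - m \<in> {1..n}" using ij by auto
    then have "H (i, j - m) < H (i', j - m)" using ij H by (auto simp: set_fillings_def)
    then show ?thesis using False ij by (simp add: join_cols_def cells_def)
  qed
  ultimately show ?thesis
    by (auto simp: set_fillings_def join_cols_def)
qed

lemma join_first_last_cols:
  assumes "F \<in> extensional (cells k (m + n))"
  shows "join_cols m n k (first_cols m k F) (last_cols m n k F) = F"
proof (rule extensionalityI[OF _ assms])
  show "join_cols m n k (first_cols m k F) (last_cols m n k F) \<in> extensional (cells k (m + n))"
    by (simp add: join_cols_def)
qed (auto simp: join_cols_def first_cols_def last_cols_def cells_def)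

lemma first_cols_join:
  assumes "G \<in> extensional (cells k m)"
  shows "first_cols m k (join_cols m n k G H) = G"
  by (rule extensionalityI[OF _ assms]) (auto simp: join_cols_def first_cols_def cells_def)

lemma last_cols_join:
  assumes "H \<in> extensional (cells k n)"
  shows "last_cols m n k (join_cols m n k G H) = H"
  by (rule extensionalityI[OF _ assms]) (auto simp: join_cols_def last_cols_def cells_def)

text \<open>
  A filling with entries from \<open>T\<close> corresponds to the set \<open>S\<close> of the entries in its first \<open>m\<close>
  columns, a filling of these columns by \<open>S\<close>, and a filling of the other columns by \<open>T - S\<close>.
\<close>

lemma sum_set_fillings_split:
  fixes f g :: "(nat \<times> nat \<Rightarrow> nat) \<Rightarrow> 'a :: comm_semiring_1"
  assumes "finite T"
  shows "(\<Sum>F\<in>set_fillings T (m + n) k. f (first_cols m k F) * g (last_cols m n k F)) =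
    (\<Sum>S | S \<subseteq> T \<and> card S = k * m.
       (\<Sum>G\<in>set_fillings S m k. f G) * (\<Sum>H\<in>set_fillings (T - S) n k. g H))"
proof -
  let ?D = "SIGMA S:{S. S \<subseteq> T \<and> card S = k * m}. set_fillings S m k \<times> set_fillings (T - S) n k"
  have "(\<Sum>F\<in>set_fillings T (m + n) k. f (first_cols m k F) * g (last_cols m n k F)) =
      (\<Sum>(S, G, H)\<in>?D. f G * g H)"
  proof (rule sum.reindex_bij_witness[where j = "\<lambda>F. (F ` cells k m, first_cols m k F, last_cols m n k F)"
        and i = "\<lambda>(S, G, H). join_cols m n k G H"])
    fix F assume F: "F \<in> set_fillings T (m + n) k"
    then show "(case (F ` cells k m, first_cols m k F, last_cols m n k F) of
        (S, G, H) \<Rightarrow> join_cols m n k G H) = F"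
      by (simp add: join_first_last_cols set_fillings_def)
    have "F ` cells k m \<subseteq> T" "card (F ` cells k m) = k * m"
      using F cells_mono[of k m n] inj_on_subset[OF _ cells_mono, of F k m n]
      by (auto simp: set_fillings_def bij_betw_def card_image)
    then show "(F ` cells k m, first_cols m k F, last_cols m n k F) \<in> ?D"
      using first_cols_in_set_fillings[OF F] last_cols_in_set_fillings[OF F] by simp
  next
    fix z assume "z \<in> ?D"
    then obtain S G H where z: "z = (S, G, H)" and "S \<subseteq> T"
      and G: "G \<in> set_fillings S m k" and H: "H \<in> set_fillings (T - S) n k"
      by auto
    have first: "first_cols m k (join_cols m n k G H) = G"
      using G by (simp add: first_cols_join set_fillings_def)
    have "join_cols m n k G H ` cells k m = first_cols m k (join_cols m n k G H) ` cells k m"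
      by (simp add: first_cols_def)
    also have "\<dots> = S"
      unfolding first using G by (simp add: set_fillings_def bij_betw_def)
    finally show "((case z of (S, G, H) \<Rightarrow> join_cols m n k G H) ` cells k m,
        first_cols m k (case z of (S, G, H) \<Rightarrow> join_cols m n k G H),
        last_cols m n k (case z of (S, G, H) \<Rightarrow> join_cols m n k G H)) = z"
      using first H by (simp add: z last_cols_join set_fillings_def)
    show "(case z of (S, G, H) \<Rightarrow> join_cols m n k G H) \<in> set_fillings T (m + n) k"
      using join_cols_in_set_fillings[OF G H \<open>S \<subseteq> T\<close>] by (simp add: z)
  qed simp
  also have "\<dots> = (\<Sum>S | S \<subseteq> T \<and> card S = k * m.
      \<Sum>(G, H)\<in>set_fillings S m k \<times> set_fillings (T - S) n k. f G * g H)"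
    using assms by (subst sum.Sigma) (auto intro: finite_set_fillings finite_subset)
  also have "\<dots> = (\<Sum>S | S \<subseteq> T \<and> card S = k * m.
       (\<Sum>G\<in>set_fillings S m k. f G) * (\<Sum>H\<in>set_fillings (T - S) n k. g H))"
    by (simp add: sum_product sum.cartesian_product)
  finally show ?thesis .
qed

text \<open>
  If the summands depend on the two parts only through their numbers of matches, which reduction
  preserves, then all sets \<open>S\<close> of entries for the first \<open>m\<close> columns contribute equally.
\<close>

lemma sum_fillings_split:
  fixes f g :: "nat \<Rightarrow> 'a :: comm_semiring_1"
  shows "(\<Sum>F\<in>fillings (m + n) k.
            f (mch m k Y (first_cols m k F)) * g (mch n k Y (last_cols m n k F))) =
    of_nat ((k * (m + n)) choose (k * m)) *
      ((\<Sum>G\<in>fillings m k. f (mch m k Y G)) * (\<Sum>H\<in>fillings n k. g (mch n k Y H)))"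
proof -
  let ?T = "{1..k * (m + n)}"
  have "card (?T - S) = k * n" if "S \<subseteq> ?T" "card S = k * m" for S
    using that by (simp add: card_Diff_subset finite_subset algebra_simps)
  then have "(\<Sum>S | S \<subseteq> ?T \<and> card S = k * m.
       (\<Sum>G\<in>set_fillings S m k. f (mch m k Y G)) * (\<Sum>H\<in>set_fillings (?T - S) n k. g (mch n k Y H))) =
     (\<Sum>S | S \<subseteq> ?T \<and> card S = k * m.
       (\<Sum>G\<in>fillings m k. f (mch m k Y G)) * (\<Sum>H\<in>fillings n k. g (mch n k Y H)))"
    by (intro sum.cong refl arg_cong2[where f = "(*)"] sum_mch_set_fillings)
       (auto intro: finite_subset)
  also have "(\<Sum>S | S \<subseteq> ?T \<and> card S = k * m.
       (\<Sum>G\<in>fillings m k. f (mch m k Y G)) * (\<Sum>H\<in>fillings n k. g (mch n k Y H))) =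
     of_nat (card {S. S \<subseteq> ?T \<and> card S = k * m}) *
       ((\<Sum>G\<in>fillings m k. f (mch m k Y G)) * (\<Sum>H\<in>fillings n k. g (mch n k Y H)))"
    by (rule sum_constant)
  also have "card {S. S \<subseteq> ?T \<and> card S = k * m} = (k * (m + n)) choose (k * m)"
    by (subst n_subsets) simp_all
  finally show ?thesis
    unfolding fillings_eq_set_fillings[of "m + n"] by (subst sum_set_fillings_split) simp_all
qed

section \<open>Matches in the two parts\<close>

lemma match_at_first_cols:
  assumes "1 \<le> i" "i < m"
  shows "match_at k Y (first_cols m k F) i \<longleftrightarrow> match_at k Y F i"
proof -
  have "subcols k (first_cols m k F) [i, i + 1] = subcols k F [i, i + 1]"
    unfolding subcols_pair using assms
    by (intro ext) (auto simp: restrict_def first_cols_def cells_def)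
  then show ?thesis by (simp add: match_at_def)
qed

lemma match_at_last_cols:
  assumes "1 \<le> i" "i < n"
  shows "match_at k Y (last_cols m n k F) i \<longleftrightarrow> match_at k Y F (i + m)"
proof -
  have "subcols k (last_cols m n k F) [i, i + 1] = subcols k F [i + m, i + m + 1]"
    unfolding subcols_pair using assms
    by (intro ext) (auto simp: restrict_def last_cols_def cells_def)
  then show ?thesis by (simp add: match_at_def)
qed

lemma mch_eq_max_iff: "mch m k Y F = m - 1 \<longleftrightarrow> (\<forall>i\<in>{1..<m}. match_at k Y F i)"
proof -
  let ?M = "{i \<in> {1..m - 1}. match_at k Y F i}"
  have "card ?M = m - 1 \<longleftrightarrow> ?M = {1..m - 1}"
  proof
    assume "card ?M = m - 1"
    then show "?M = {1..m - 1}" by (intro card_subset_eq) auto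
  next
    assume "?M = {1..m - 1}"
    then have "card ?M = card {1..m - 1}" by (rule arg_cong)
    then show "card ?M = m - 1" by simp
  qed
  also have "\<dots> \<longleftrightarrow> (\<forall>i\<in>{1..<m}. match_at k Y F i)" by fastforce
  finally show ?thesis by (simp only: mch_def)
qed

lemma mch_first_cols_eq_max_iff:
  "mch m k Y (first_cols m k F) = m - 1 \<longleftrightarrow> (\<forall>i\<in>{1..<m}. match_at k Y F i)"
  unfolding mch_eq_max_iff by (intro ball_cong refl match_at_first_cols) auto

lemma mch_last_cols:
  "mch n k Y (last_cols m n k F) = card {i \<in> {m + 1..m + n - 1}. match_at k Y F i}"
proof -
  have "bij_betw (\<lambda>i. i + m) {i \<in> {1..n - 1}. match_at k Y (last_cols m n k F) i}
      {i \<in> {m + 1..m + n - 1}. match_at k Y F i}"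
    by (rule bij_betw_byWitness[where f' = "\<lambda>i. i - m"]) (auto simp: match_at_last_cols)
  then show ?thesis
    unfolding mch_def by (rule bij_betw_same_card)
qed

text \<open>The value that is set by convention for a single column is no exception.\<close>

lemma full_eq: "full k Y m = card {F \<in> fillings m k. mch m k Y F = m - 1}"
  using full_1_consistent[of k Y] by (cases "m = 1") (simp_all add: full_def)

text \<open>
  Let \<open>p\<close> be the least element of \<open>{1..n}\<close> that is \<open>n\<close> or violates \<open>P\<close>. Only the terms with
  \<open>m \<le> p\<close> contribute, and up to a common power of \<open>x\<close>, which counts the positions above \<open>p\<close>,
  the claim is the geometric sum for \<open>x ^ (p - 1) - (x - 1) ^ (p - 1)\<close>, in which the factor
  \<open>x - (x - 1)\<close> is 1, with \<open>(x - 1) ^ (p - 1)\<close> as the term for \<open>m = p\<close>.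
  The proof telescopes instead of naming \<open>p\<close>: for \<open>m < n\<close>, the \<open>m\<close>-th term is the difference of
  \<open>(x - 1) ^ (m - 1) * x ^ c\<close>, where \<open>c\<close> counts \<open>P\<close> on \<open>{m..n - 1}\<close> and the product is set to 0 unless \<open>P\<close> holds on all of \<open>{1..<m}\<close>, and the same expression at \<open>m + 1\<close>.
\<close>

lemma power_count_eq_sum_runs:
  fixes x :: "'a :: comm_ring_1"
  assumes "n \<ge> 1"
  shows "x ^ card {i \<in> {1..n - 1}. P i} =
    (\<Sum>m = 1..n. (x - 1) ^ (m - 1) *
       (of_bool (\<forall>i\<in>{1..<m}. P i) * x ^ card {i \<in> {m + 1..n - 1}. P i}))"
proof -
  let ?run = "\<lambda>m. of_bool (\<forall>i\<in>{1..<m}. P i) :: 'a"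
  let ?t = "\<lambda>m. (x - 1) ^ (m - 1) * (?run m * x ^ card {i \<in> {m + 1..n - 1}. P i})"
  let ?g = "\<lambda>m. (x - 1) ^ (m - 1) * (?run m * x ^ card {i \<in> {m..n - 1}. P i})"
  have step: "?g m = ?t m + ?g (Suc m)" if "1 \<le> m" "m < n" for m
  proof -
    have "{m..n - 1} = insert m {m + 1..n - 1}" using that by auto
    then have "{i \<in> {m..n - 1}. P i} =
        (if P m then insert m {i \<in> {m + 1..n - 1}. P i} else {i \<in> {m + 1..n - 1}. P i})"
      by auto
    then have "card {i \<in> {m..n - 1}. P i} = of_bool (P m) + card {i \<in> {m + 1..n - 1}. P i}"
      by simp
    moreover have "{1..<Suc m} = insert m {1..<m}" using that by auto
    then have "?run (Suc m) = of_bool (P m) * ?run m" by simp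
    moreover obtain l where "m = Suc l" using \<open>1 \<le> m\<close> by (cases m) auto
    ultimately show ?thesis by (simp add: algebra_simps)
  qed
  have "?g 1 = (\<Sum>m = 1..p. ?t m) + ?g (Suc p)" if "p < n" for p
    using that
  proof (induction p)
    case (Suc p)
    then show ?case using step[of "Suc p"] by (simp add: add.assoc)
  qed simp
  from this[of "n - 1"] have "?g 1 = (\<Sum>m = 1..n - 1. ?t m) + ?g n"
    using assms by simp
  \<comment> \<open>The last term needs no difference, since no position is left to count.\<close>
  also have "?g n = ?t n"
  proof -
    have "{n..n - 1} = {}" "{n + 1..n - 1} = {}" using assms by auto
    then show ?thesis by simp
  qed
  also have "sum h {1..n - 1} + h n = sum h {1..n}" for h :: "nat \<Rightarrow> 'a"
    using assms by (cases n) simp_all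
  finally show ?thesis by simp
qed

lemma sum_fillings_recurrence:
  fixes x :: "'a :: comm_ring_1"
  assumes "n \<ge> 1"
  shows "(\<Sum>F\<in>fillings n k. x ^ mch n k Y F) =
    (\<Sum>m = 1..n. (x - 1) ^ (m - 1) * (of_nat ((k * n) choose (k * m)) *
       (of_nat (full k Y m) * (\<Sum>F\<in>fillings (n - m) k. x ^ mch (n - m) k Y F))))"
proof -
  have "(\<Sum>F\<in>fillings n k. x ^ mch n k Y F) =
      (\<Sum>m = 1..n. (x - 1) ^ (m - 1) * (\<Sum>F\<in>fillings n k.
        of_bool (\<forall>i\<in>{1..<m}. match_at k Y F i) * x ^ card {i \<in> {m + 1..n - 1}. match_at k Y F i}))"
    unfolding mch_def power_count_eq_sum_runs[OF assms]
    by (subst sum.swap) (simp only: sum_distrib_left)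
  also have "\<dots> = (\<Sum>m = 1..n. (x - 1) ^ (m - 1) * (of_nat ((k * n) choose (k * m)) *
       (of_nat (full k Y m) * (\<Sum>F\<in>fillings (n - m) k. x ^ mch (n - m) k Y F))))"
  proof (rule sum.cong[OF refl], rule arg_cong[where f = "(*) _"])
    fix m assume "m \<in> {1..n}"
    then have n: "n = m + (n - m)" by simp
    have "(\<Sum>G\<in>fillings m k. of_bool (mch m k Y G = m - 1)) = (of_nat (full k Y m) :: 'a)"
      by (simp add: full_eq finite_fillings Int_def sum.If_cases of_bool_def)
    with sum_fillings_split[of "\<lambda>r. of_bool (r = m - 1)" m k Y "\<lambda>r. x ^ r" "n - m"]
    show "(\<Sum>F\<in>fillings n k. of_bool (\<forall>i\<in>{1..<m}. match_at k Y F i) *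
          x ^ card {i \<in> {m + 1..n - 1}. match_at k Y F i}) =
        of_nat ((k * n) choose (k * m)) *
          (of_nat (full k Y m) * (\<Sum>F\<in>fillings (n - m) k. x ^ mch (n - m) k Y F))"
      by (simp only: mch_first_cols_eq_max_iff mch_last_cols n[symmetric])
  qed
  finally show ?thesis .
qed

section \<open>The generating function\<close>

lemma of_nat_fract_eq_0_iff: "(of_nat n :: ratfun) = 0 \<longleftrightarrow> n = 0"
proof -
  have "(of_nat n :: ratfun) = to_fract (of_nat n)"
    by (induction n) simp_all
  then show ?thesis by simp
qed

lemma x_var_neq_1: "x_var \<noteq> 1"
proof
  assume "x_var = 1"
  then have "to_fract [:0, 1 :: rat:] = to_fract 1" by (simp add: x_var_def)
  then show False by (simp only: to_fract_eq_iff) (simp add: one_pCons)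
qed

lemma sum_fillings_0: "(\<Sum>F\<in>fillings 0 k. x ^ mch 0 k Y F) = (1 :: 'a :: comm_semiring_1)"
proof -
  have "fillings 0 k = {\<lambda>_. undefined}"
    by (auto simp: fillings_def cells_def bij_betw_def)
  then show ?thesis by (simp add: mch_def)
qed

lemma D_series_nth:
  "fps_nth (D_series k Y) n = (\<Sum>F\<in>fillings n k. x_var ^ mch n k Y F) / of_nat (fact (k * n))"
  by (cases "n = 0") (simp_all add: D_series_def sum_fillings_0)

theorem theorem2:
  fixes k :: nat and \<Upsilon> :: "(nat \<times> nat \<Rightarrow> nat) set"
  assumes "k \<ge> 1" and "\<Upsilon> \<subseteq> fillings 2 k"
  shows "D_series k \<Upsilon> = fps_const (1 - x_var) / (fps_const (1 - x_var) + full_series k \<Upsilon>)"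
proof -
  let ?B = "fps_const (1 - x_var) + full_series k \<Upsilon>"
  let ?A = "\<lambda>n. \<Sum>F\<in>fillings n k. x_var ^ mch n k \<Upsilon> F"
  let ?f = "\<lambda>m. of_nat (fact (k * m)) :: ratfun"
  have nz: "?f m \<noteq> 0" for m
    unfolding of_nat_fract_eq_0_iff by simp
  have full_0: "fps_nth (full_series k \<Upsilon>) 0 = 0"
    by (simp add: full_series_def)
  have "D_series k \<Upsilon> * ?B = fps_const (1 - x_var)"
  proof (rule fps_ext)
    fix n
    show "fps_nth (D_series k \<Upsilon> * ?B) n = fps_nth (fps_const (1 - x_var)) n"
    proof (cases "n = 0")
      case True
      then show ?thesis by (simp add: full_0 D_series_nth sum_fillings_0)
    next
      case False
      then have "n \<ge> 1" by simp
      note recurrence = sum_fillings_recurrence[OF this, of x_var k \<Upsilon>]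
      \<comment> \<open>The binomial coefficient turns the factorial for \<open>n\<close> columns into those of the two parts.\<close>
      have summand: "(x_var - 1) * ((x_var - 1) ^ (m - 1) * (of_nat ((k * n) choose (k * m)) *
            (of_nat (full k \<Upsilon> m) * ?A (n - m)))) / ?f n =
          fps_nth (full_series k \<Upsilon>) m * fps_nth (D_series k \<Upsilon>) (n - m)"
        if "m \<in> {1..n}" for m
      proof -
        have le: "k * m \<le> k * n"
          using that by simp
        have diff: "k * n - k * m = k * (n - m)"
          by (simp only: diff_mult_distrib2)
        have "fact (k * m) * fact (k * (n - m)) * ((k * n) choose (k * m)) = (fact (k * n) :: nat)"
          using binomial_fact_lemma[OF le] by (simp only: diff)
        from this[symmetric]
        have fact: "?f n = ?f m * ?f (n - m) * of_nat ((k * n) choose (k * m))"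
          by (simp only: of_nat_mult)
        have binom: "of_nat ((k * n) choose (k * m)) \<noteq> (0 :: ratfun)"
          using le by (simp only: of_nat_fract_eq_0_iff binomial_eq_0_iff linorder_not_less)
        have power: "(x_var - 1) * (x_var - 1) ^ (m - 1) = (x_var - 1) ^ m"
          using that by (cases m) simp_all
        have cancel: "a * (b * (c * (d * e))) / (p * q * c) = a * b / p * d * (e / q)"
          if "c \<noteq> 0" for a b c d e p q :: ratfun
        proof -
          have "a * (b * (c * (d * e))) / (p * q * c) = (a * b * d * e) * c / ((p * q) * c)"
            by (simp only: mult_ac)
          also have "\<dots> = (a * b * d * e) / (p * q)"
            using that by (rule nonzero_mult_divide_mult_cancel_right)
          also have "\<dots> = a * b / p * d * (e / q)"
            by (simp only: times_divide_eq_left times_divide_eq_right divide_divide_eq_left mult_ac)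
          finally show ?thesis .
        qed
        have "m \<noteq> 0" using that by simp
        then show ?thesis
          unfolding fact cancel[OF binom] power D_series_nth
          by (simp only: full_series_def fps_nth_Abs_fps if_False)
      qed
      have "(x_var - 1) * ?A n / ?f n =
          (\<Sum>m = 1..n. fps_nth (full_series k \<Upsilon>) m * fps_nth (D_series k \<Upsilon>) (n - m))"
        by (subst recurrence, subst sum_distrib_left, subst sum_divide_distrib)
           (rule sum.cong[OF refl summand])
      also have "\<dots> = (\<Sum>m = 0..n. fps_nth (full_series k \<Upsilon>) m * fps_nth (D_series k \<Upsilon>) (n - m))"
        by (intro sum.mono_neutral_left) (auto simp: full_0 not_le)
      finally have "fps_nth (full_series k \<Upsilon> * D_series k \<Upsilon>) n = (x_var - 1) * ?A n / ?f n"
        unfolding fps_mult_nth by (rule sym)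
      moreover have "D_series k \<Upsilon> * ?B =
          fps_const (1 - x_var) * D_series k \<Upsilon> + full_series k \<Upsilon> * D_series k \<Upsilon>"
        by (simp only: distrib_left mult.commute[of "D_series k \<Upsilon>"])
      ultimately have "fps_nth (D_series k \<Upsilon> * ?B) n =
          (1 - x_var) * (?A n / ?f n) + (x_var - 1) * ?A n / ?f n"
        by (simp only: fps_add_nth fps_mult_left_const_nth D_series_nth)
      also have "\<dots> = 0"
        by (simp only: times_divide_eq_right add_divide_distrib[symmetric] distrib_right[symmetric])
           simp
      finally show ?thesis using False by simp
    qed
  qed
  moreover have "?B \<noteq> 0"
  proof
    assume "?B = 0"
    then have "fps_nth ?B 0 = 0" by simp
    then show False using x_var_neq_1 by (simp add: full_0)
  qed
  ultimately show ?thesis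
    using nonzero_mult_div_cancel_right[of ?B "D_series k \<Upsilon>"] by simp
qed

end
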